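(* Let $A$ and $B$ be compact sets in $\mathbb{R}^2$. Then $$d^2(A+B)\leq d^2(A)+d^2(B).$$ Moreover, this is the best upper bound for $d(A+B)$ in terms of $d(A)$ and $d(B)$ in the following sense: if $d_A$ and $d_B$ are non-negative real numbers, then there exist compact sets $A$ and $B$ in $\mathbb{R}^2$ such that $d(A)=d_A$, $d(B)=d_B$, and $d^2(A+B)=d_A^2+d_B^2$.
   Context: For a compact set $A\subseteq\mathbb{R}^n$, the Hausdorff distance from $A$ to its convex hull is $d(A):=\sup_{a\in\textup{conv}(A)}\inf_{x\in A}|x-a|$, where $|\cdot|$ is the Euclidean norm. Here $d^2(A)$ means $(d(A))^2$, and $A+B=\{a+b: a\in A,\ b\in B\}$ is the Minkowski sum. *)

theory Defs
  imports "HOL-Analysis.Analysis" "HOL-Library.Set_Algebras"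
begin

text \<open>
  The supremum and infimum are taken in the reals, so the value at the empty set is an
  unspecified real number; for a nonempty bounded set they are the genuine ones.
\<close>

definition hull_dist :: "'a::euclidean_space set \<Rightarrow> real" where
  "hull_dist A = (SUP a \<in> convex hull A. INF x \<in> A. norm (x - a))"

end

theory Submission
  imports Defs
begin

text \<open>
  For a point \<open>x\<close> of \<open>conv (A + B)\<close>, the hulls of \<open>A\<close> and \<open>C = x - B\<close> meet, and the claim is
  that some \<open>a \<in> A\<close>, \<open>c \<in> C\<close> satisfy \<open>|a - c|\<^sup>2 \<le> d(A)\<^sup>2 + d(B)\<^sup>2\<close>. This is clear if a point of
  one set lies in the hull of the other. Otherwise, in the plane, some segment with endpoints in
  \<open>A\<close> crosses some segment with endpoints in \<open>C\<close>; choose such a pair of least total length.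
  A point of \<open>A\<close> in the open disc with the first segment as diameter could replace one of its
  endpoints and shorten it, so there is none; hence the midpoint shows that the
  segment has length at most \<open>2 d(A)\<close>, and likewise the other one at most \<open>2 d(B)\<close>. Averaging
  the four squared distances between endpoints then gives the bound. Two orthogonal
  segments' endpoint pairs attain it.
\<close>

section \<open>Crossing segments and convex hulls in the plane\<close>

text \<open>The line through \<open>c0\<close> and \<open>c1\<close> weakly separates
  \<open>a0\<close> from \<open>a1\<close>, so it also meets an edge of the triangle at
  \<open>a\<close>, say in \<open>p\<close>. If \<open>p\<close> is not between \<open>c0\<close>
  and \<open>c1\<close>, then the stretch of this line from \<open>p\<close> to the old crossing
  point \<open>s\<close> stays in the triangle and passes over \<open>c0\<close> or
  \<open>c1\<close>.\<close>

lemma segment_exchange: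
  fixes a a0 a1 c0 c1 :: "real^2"
  assumes meet: "closed_segment a0 a1 \<inter> closed_segment c0 c1 \<noteq> {}"
  shows "closed_segment a a0 \<inter> closed_segment c0 c1 \<noteq> {} \<or>
         closed_segment a a1 \<inter> closed_segment c0 c1 \<noteq> {} \<or>
         c0 \<in> convex hull {a, a0, a1} \<or> c1 \<in> convex hull {a, a0, a1}"
proof -
  let ?T = "convex hull {a, a0, a1}"
  obtain s where s: "s \<in> closed_segment a0 a1" "s \<in> closed_segment c0 c1"
    using meet by auto
  have sub: "closed_segment a0 a1 \<subseteq> ?T" "closed_segment a a0 \<subseteq> ?T" "closed_segment a a1 \<subseteq> ?T"
    by (simp_all add: closed_segment_subset hull_inc convex_convex_hull)
  define d where "d = c1 - c0"
  show ?thesis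
  proof (cases "d = 0")
    case True
    \<comment> \<open>The segment degenerates to the point \<open>c0\<close>, which equals
      \<open>s\<close>.\<close>
    then show ?thesis using s sub by (auto simp: d_def)
  next
    case False
    \<comment> \<open>\<open>f x\<close> is the determinant of \<open>x - c0\<close> and
      \<open>d\<close>: an affine function whose zero set is the line through \<open>c0\<close> and
      \<open>c1\<close>.\<close>
    define f where "f = (\<lambda>x::real^2. (x $ 1 - c0 $ 1) * d $ 2 - (x $ 2 - c0 $ 2) * d $ 1)"
    have f_affine: "f ((1 - t) *\<^sub>R x + t *\<^sub>R y) = (1 - t) * f x + t * f y" for t x y
      unfolding f_def by (simp add: algebra_simps)
    obtain \<sigma> where \<sigma>: "0 \<le> \<sigma>" "\<sigma> \<le> 1" "s = c0 + \<sigma> *\<^sub>R d"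
      using s(2) unfolding closed_segment_def d_def by (auto simp: algebra_simps)
    have fs: "f s = 0" unfolding \<sigma> f_def by simp
    obtain \<tau> where \<tau>: "0 \<le> \<tau>" "\<tau> \<le> 1" "s = (1 - \<tau>) *\<^sub>R a0 + \<tau> *\<^sub>R a1"
      using s(1) unfolding closed_segment_def by auto
    have zero: "\<exists>p \<in> closed_segment x y. f p = 0" if "f x * f y \<le> 0" for x y
    proof -
      have "\<exists>t. 0 \<le> t \<and> t \<le> 1 \<and> (1 - t) * f x + t * f y = 0"
      proof (cases "f x = f y")
        case True
        then have "f x = 0" "f y = 0" using that by (auto simp: mult_le_0_iff)
        then show ?thesis by (intro exI[of _ 0]) auto
      next
        case False
        \<comment> \<open>This parameter is the root of the linear interpolation between
          \<open>f x\<close> and \<open>f y\<close>.\<close>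
        have "0 \<le> f x / (f x - f y)" "f x / (f x - f y) \<le> 1"
          using that False by (auto simp: field_simps mult_le_0_iff divide_le_eq zero_le_divide_iff)
        moreover have "(1 - f x / (f x - f y)) * f x + f x / (f x - f y) * f y = 0"
          using False by (simp add: field_simps)
        ultimately show ?thesis by blast
      qed
      then show ?thesis unfolding closed_segment_def using f_affine by force
    qed
    have "f a0 * f a1 \<le> 0"
    proof (rule ccontr)
      assume "\<not> f a0 * f a1 \<le> 0"
      then have "(f a0 > 0 \<and> f a1 > 0) \<or> (f a0 < 0 \<and> f a1 < 0)"
        by (auto simp: not_le zero_less_mult_iff)
      moreover have "(1 - \<tau>) * f a0 + \<tau> * f a1 = 0"
        using fs f_affine \<tau>(3) by simp
      ultimately show False
        using \<tau>(1,2) convex_bound_lt[of "f a0" 0 "f a1" "1 - \<tau>" \<tau>]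
          convex_bound_lt[of "- f a0" 0 "- f a1" "1 - \<tau>" \<tau>] by auto
    qed
    \<comment> \<open>\<open>f a0\<close> and \<open>f a1\<close> do not share a strict sign, so
      \<open>f a\<close> is weakly opposite to one of them.\<close>
    then have "f a * f a0 \<le> 0 \<or> f a * f a1 \<le> 0"
      by (auto simp: mult_le_0_iff)
    then obtain p where p: "p \<in> closed_segment a a0 \<union> closed_segment a a1" "f p = 0"
      using zero by blast
    have "\<exists>t. p = c0 + t *\<^sub>R d"
    proof (cases "d $ 1 = 0")
      case True
      then have "d $ 2 \<noteq> 0" using False by (auto simp: vec_eq_iff forall_2)
      then show ?thesis using p(2) True unfolding f_def
        by (intro exI[of _ "(p $ 2 - c0 $ 2) / d $ 2"]) (auto simp: vec_eq_iff forall_2)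
    next
      case nz: False
      then show ?thesis using p(2) unfolding f_def
        by (intro exI[of _ "(p $ 1 - c0 $ 1) / d $ 1"]) (auto simp: vec_eq_iff forall_2 field_simps)
    qed
    then obtain t where t: "p = c0 + t *\<^sub>R d" by blast
    have pT: "p \<in> ?T" using p sub by blast
    have sT: "s \<in> ?T" using s sub by blast
    have between: "c0 + r *\<^sub>R d \<in> ?T" if "r \<in> closed_segment t \<sigma>" for r
    proof -
      obtain u where u: "0 \<le> u" "u \<le> 1" "r = (1 - u) * t + u * \<sigma>"
        using \<open>r \<in> closed_segment t \<sigma>\<close> unfolding closed_segment_def by auto
      have "c0 + r *\<^sub>R d = (1 - u) *\<^sub>R p + u *\<^sub>R s"
        unfolding t \<sigma>(3) u(3) by (simp add: algebra_simps)
      then show ?thesis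
        using convexD_alt[OF convex_convex_hull pT sT u(1,2)] by simp
    qed
    consider "t < 0" | "t > 1" | "0 \<le> t" "t \<le> 1" by linarith
    then show ?thesis
    proof cases
      case 1
      then have "c0 \<in> ?T" using between[of 0] \<sigma> by (auto simp: closed_segment_eq_real_ivl)
      then show ?thesis by blast
    next
      case 2
      then have "c1 \<in> ?T" using between[of 1] \<sigma> by (auto simp: closed_segment_eq_real_ivl d_def)
      then show ?thesis by blast
    next
      case 3
      have "p = (1 - t) *\<^sub>R c0 + t *\<^sub>R c1" unfolding t d_def by (simp add: algebra_simps)
      then have "p \<in> closed_segment c0 c1" unfolding closed_segment_def using 3 by blast
      then show ?thesis using p(1) by blast
    qed
  qed
qed

text \<open>By Caratheodory, \<open>s\<close> lies in a triangle with vertices in \<open>S\<close>.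
  The segment from \<open>s\<close> to \<open>q\<close> leaves this triangle, so it meets the
  boundary, which consists of the edges.\<close>

lemma segment_leaving_hull_crosses_edge:
  fixes S :: "(real^2) set"
  assumes s: "s \<in> convex hull S" and q: "q \<notin> convex hull S"
  shows "\<exists>x\<in>S. \<exists>y\<in>S. closed_segment x y \<inter> closed_segment s q \<noteq> {}"
proof -
  obtain T where T: "finite T" "T \<subseteq> S" "card T \<le> DIM(real^2) + 1" "s \<in> convex hull T"
    using s unfolding caratheodory[of S] by auto
  have "card T \<noteq> 0" using T by auto
  moreover have "card T \<le> 3" using T(3) by simp
  ultimately have "card T = 1 \<or> card T = 2 \<or> card T = 3" by linarith
  \<comment> \<open>Repeated vertices are allowed: \<open>frontier_of_triangle\<close> also covers
    degenerate triangles.\<close>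
  then obtain a b c where abc: "T = {a, b, c}"
    by (auto simp: card_1_singleton_iff card_2_iff card_3_iff)
  have "q \<notin> convex hull T" using q T(2) hull_mono by blast
  then have "closed_segment s q \<inter> frontier (convex hull T) \<noteq> {}"
    using T(4) by (intro connected_Int_frontier) auto
  then have "closed_segment s q \<inter>
      (closed_segment a b \<union> closed_segment b c \<union> closed_segment c a) \<noteq> {}"
    unfolding abc using frontier_of_triangle[of a b c] by simp
  then show ?thesis using T(2) unfolding abc by blast
qed

text \<open>The crossing pair comes from leaving a hull twice: the way from a common point
  \<open>s\<close> to some \<open>c\<close> outside the hull of \<open>A\<close> crosses a segment
  \<open>[a0, a1]\<close> at \<open>p\<close>, and the way from \<open>p\<close> to
  \<open>a0\<close>, outside the hull of \<open>C\<close>, crosses a segment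
  \<open>[c0, c1]\<close>.\<close>

lemma hulls_meet_cases:
  fixes A C :: "(real^2) set"
  assumes "convex hull A \<inter> convex hull C \<noteq> {}"
  obtains (left) a where "a \<in> A" "a \<in> convex hull C"
    | (right) c where "c \<in> C" "c \<in> convex hull A"
    | (cross) a0 a1 c0 c1 where "a0 \<in> A" "a1 \<in> A" "c0 \<in> C" "c1 \<in> C"
        "closed_segment a0 a1 \<inter> closed_segment c0 c1 \<noteq> {}"
proof -
  obtain s where s: "s \<in> convex hull A" "s \<in> convex hull C" using assms by blast
  have "C \<noteq> {}" using s by auto
  then obtain c where c: "c \<in> C" by blast
  show thesis
  proof (cases "c \<in> convex hull A")
    case True
    then show thesis using c right by blast
  next
    case False
    from segment_leaving_hull_crosses_edge[OF s(1) False] obtain a0 a1 p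
      where a: "a0 \<in> A" "a1 \<in> A" "p \<in> closed_segment a0 a1" "p \<in> closed_segment s c" by blast
    have pC: "p \<in> convex hull C"
      using a(4) s(2) c closed_segment_subset[OF s(2) hull_inc[OF c] convex_convex_hull] by blast
    show thesis
    proof (cases "a0 \<in> convex hull C")
      case True
      then show thesis using a left by blast
    next
      case False
      from segment_leaving_hull_crosses_edge[OF pC False] obtain c0 c1
        where "c0 \<in> C" "c1 \<in> C" "closed_segment c0 c1 \<inter> closed_segment p a0 \<noteq> {}" by blast
      moreover have "closed_segment p a0 \<subseteq> closed_segment a0 a1"
        using a(3) by (simp add: subset_closed_segment)
      ultimately show thesis using cross[of a0 a1 c0 c1] a by blast
    qed
  qed
qed

text \<open>
  Weighting the pairs of endpoints by the product of the barycentric weights of a common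
  point, the mean squared distance is the sum of the two variances.
\<close>

lemma crossing_segments_close_endpoints:
  fixes a0 a1 c0 c1 :: "'a::real_inner"
  assumes meet: "closed_segment a0 a1 \<inter> closed_segment c0 c1 \<noteq> {}"
    and p: "dist a0 a1 \<le> 2 * p" and q: "dist c0 c1 \<le> 2 * q"
  shows "\<exists>a\<in>{a0, a1}. \<exists>c\<in>{c0, c1}. (dist a c)\<^sup>2 \<le> p\<^sup>2 + q\<^sup>2"
proof (rule ccontr)
  assume contr: "\<not> ?thesis"
  obtain t l where t: "0 \<le> t" "t \<le> 1" and l: "0 \<le> l" "l \<le> 1"
    and eq: "(1 - t) *\<^sub>R a0 + t *\<^sub>R a1 = (1 - l) *\<^sub>R c0 + l *\<^sub>R c1"
    using meet unfolding closed_segment_def by auto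
  let ?m = "(1 - l) *\<^sub>R c0 + l *\<^sub>R c1"
  define D where "D x y = (dist x y)\<^sup>2" for x y :: 'a
  have D_inner: "D x y = (x - y) \<bullet> (x - y)" for x y :: 'a
    by (simp add: D_def dist_norm power2_norm_eq_inner)
  \<comment> \<open>Stewart's identity: moving the weighted squared distances to the weighted mean
    costs the variance of the pair.\<close>
  have D_affine: "(1 - u) * D x z + u * D y z
      = D ((1 - u) *\<^sub>R x + u *\<^sub>R y) z + u * (1 - u) * D x y" for u x y z
    unfolding D_inner by (simp add: inner_commute algebra_simps power2_eq_square)
  have D_sym: "D x y = D y x" for x y by (simp add: D_def dist_commute)
  have "(1 - l) * ((1 - t) * D a0 c0 + t * D a1 c0) + l * ((1 - t) * D a0 c1 + t * D a1 c1)
      = ((1 - l) * D c0 ?m + l * D c1 ?m) + t * (1 - t) * D a0 a1"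
    unfolding D_affine[of t a0 _ a1] eq D_sym[of c0 ?m] D_sym[of c1 ?m]
    by (simp add: algebra_simps)
  also have "\<dots> = l * (1 - l) * D c0 c1 + t * (1 - t) * D a0 a1"
    unfolding D_affine[of l c0 ?m c1] by (simp add: D_def)
  also have "\<dots> \<le> q\<^sup>2 + p\<^sup>2"
  proof -
    \<comment> \<open>The maximum 1/4 of \<open>u * (1 - u)\<close> cancels the square of the factor
      2 in the length bound.\<close>
    have quarter: "u * (1 - u) * D x y \<le> r\<^sup>2"
      if "0 \<le> u" "u \<le> 1" "dist x y \<le> 2 * r" for u x y r
    proof -
      have "u * (1 - u) \<le> 1 / 4"
        using zero_le_power2[of "u - 1 / 2"] by (simp add: power2_eq_square algebra_simps)
      moreover have "D x y \<le> (2 * r)\<^sup>2" unfolding D_def using that by (intro power_mono) auto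
      moreover have "0 \<le> D x y" by (simp add: D_def)
      ultimately have "u * (1 - u) * D x y \<le> 1 / 4 * (2 * r)\<^sup>2"
        using that by (intro mult_mono) auto
      then show ?thesis by (simp add: power2_eq_square)
    qed
    show ?thesis using quarter[OF l q] quarter[OF t p] by linarith
  qed
  finally have le: "(1 - l) * ((1 - t) * D a0 c0 + t * D a1 c0)
      + l * ((1 - t) * D a0 c1 + t * D a1 c1) \<le> p\<^sup>2 + q\<^sup>2" by simp
  have big: "D a0 c0 > p\<^sup>2 + q\<^sup>2" "D a1 c0 > p\<^sup>2 + q\<^sup>2" "D a0 c1 > p\<^sup>2 + q\<^sup>2" "D a1 c1 > p\<^sup>2 + q\<^sup>2"
    using contr unfolding D_def by auto
  have mean_gt: "(1 - u) * x + u * y > r" if "x > r" "y > r" "0 \<le> u" "u \<le> 1" for u x y r :: real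
    using convex_bound_lt[of "- x" "- r" "- y" "1 - u" u] that by auto
  show False
    using mean_gt[OF mean_gt[OF big(1,2) t] mean_gt[OF big(3,4) t] l] le by simp
qed

section \<open>Shortest crossing pairs\<close>

lemma dist_lt_if_in_diameter_ball:
  fixes a0 a1 a :: "'a::real_normed_vector"
  assumes "dist a (midpoint a0 a1) < dist a0 a1 / 2"
  shows "dist a a0 < dist a0 a1" "dist a a1 < dist a0 a1"
proof -
  show "dist a a0 < dist a0 a1"
    using assms dist_triangle[of a a0 "midpoint a0 a1"] by (simp add: dist_midpoint)
  show "dist a a1 < dist a0 a1"
    using assms dist_triangle[of a a1 "midpoint a0 a1"] by (simp add: dist_midpoint)
qed

text \<open>A segment longer than \<open>2 * p\<close> would have a point \<open>a\<close> of
  \<open>A\<close> in its open diameter disc. Exchanging an endpoint for \<open>a\<close> keeps a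
  crossing, since \<open>outside\<close> rules out the triangle cases, and shortens the segment.
  Keeping the other segment fixed lets the lemma serve both sets.\<close>

lemma no_shorter_crossing_imp_short:
  fixes A :: "(real^2) set"
  assumes meet: "closed_segment a0 a1 \<inter> closed_segment c0 c1 \<noteq> {}"
    and in_A: "a0 \<in> A" "a1 \<in> A" and outside: "c0 \<notin> convex hull A" "c1 \<notin> convex hull A"
    and min: "\<And>x y. \<lbrakk>x \<in> A; y \<in> A; closed_segment x y \<inter> closed_segment c0 c1 \<noteq> {}\<rbrakk>
                \<Longrightarrow> dist a0 a1 \<le> dist x y"
    and p: "\<And>s. s \<in> convex hull A \<Longrightarrow> \<exists>a\<in>A. dist a s \<le> p"
  shows "dist a0 a1 \<le> 2 * p"
proof (rule ccontr)
  assume "\<not> ?thesis"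
  moreover have "midpoint a0 a1 \<in> convex hull A"
    using closed_segment_subset[of a0 "convex hull A" a1] in_A midpoint_in_closed_segment[of a0 a1]
    by (auto simp: hull_inc)
  then obtain a where a: "a \<in> A" "dist a (midpoint a0 a1) \<le> p" using p by blast
  ultimately have closer: "dist a a0 < dist a0 a1" "dist a a1 < dist a0 a1"
    using dist_lt_if_in_diameter_ball[of a a0 a1] by auto
  have "convex hull {a, a0, a1} \<subseteq> convex hull A" using a in_A by (intro hull_mono) auto
  with segment_exchange[OF meet, of a] outside
  have "closed_segment a a0 \<inter> closed_segment c0 c1 \<noteq> {} \<or>
        closed_segment a a1 \<inter> closed_segment c0 c1 \<noteq> {}" by blast
  then show False using min[of a a0] min[of a a1] a in_A closer by fastforce
qed

text \<open>Minimising the sum of the lengths makes each segment shortest among those crossing the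
  other.\<close>

lemma exists_shortest_crossing:
  fixes A C :: "'a::euclidean_space set"
  assumes "compact A" "compact C" and a: "a0 \<in> A" "a1 \<in> A" and c: "c0 \<in> C" "c1 \<in> C"
    and meet: "closed_segment a0 a1 \<inter> closed_segment c0 c1 \<noteq> {}"
  obtains x y z w where "x \<in> A" "y \<in> A" "z \<in> C" "w \<in> C"
    "closed_segment x y \<inter> closed_segment z w \<noteq> {}"
    "\<And>x' y' z' w'. \<lbrakk>x' \<in> A; y' \<in> A; z' \<in> C; w' \<in> C;
        closed_segment x' y' \<inter> closed_segment z' w' \<noteq> {}\<rbrakk>
        \<Longrightarrow> dist x y + dist z w \<le> dist x' y' + dist z' w'"
proof -
  let ?P = "(A \<times> A) \<times> (C \<times> C) \<times> ({0..1::real} \<times> {0..1::real})"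
  \<comment> \<open>Recording the parameters \<open>t\<close> and \<open>l\<close> of a common point
    turns crossing into a closed equation, so \<open>Q\<close> is compact.\<close>
  define Q where "Q = ?P \<inter> {((x, y), (z, w), t, l).
      (1 - t) *\<^sub>R x + t *\<^sub>R y = (1 - l) *\<^sub>R z + l *\<^sub>R w}"
  have Q_iff: "(\<exists>t l. ((x, y), (z, w), t, l) \<in> Q) \<longleftrightarrow>
      x \<in> A \<and> y \<in> A \<and> z \<in> C \<and> w \<in> C \<and> closed_segment x y \<inter> closed_segment z w \<noteq> {}"
    for x y z w unfolding Q_def closed_segment_def by (auto simp: disjoint_iff)
  have "compact ?P" using assms by (intro compact_Times) auto
  moreover have "closed {((x, y), (z, w), t, l).
      (1 - t) *\<^sub>R x + t *\<^sub>R y = (1 - l) *\<^sub>R z + l *\<^sub>R (w::'a)}"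
    unfolding case_prod_unfold by (intro closed_Collect_eq continuous_intros)
  ultimately have "compact Q" unfolding Q_def by (rule compact_Int_closed)
  moreover have "Q \<noteq> {}" using Q_iff[of a0 a1 c0 c1] a c meet by blast
  moreover have "continuous_on Q (\<lambda>((x, y), (z, w), t, l). dist x y + dist z w)"
    unfolding case_prod_unfold by (intro continuous_intros)
  ultimately obtain v where "v \<in> Q" and "\<forall>v'\<in>Q.
      (\<lambda>((x, y), (z, w), t, l). dist x y + dist z w) v
      \<le> (\<lambda>((x, y), (z, w), t, l). dist x y + dist z w) v'"
    using continuous_attains_inf by blast
  then obtain x y z w where "\<exists>t l. ((x, y), (z, w), t, l) \<in> Q"
    and "\<And>x' y' z' w' t l. ((x', y'), (z', w'), t, l) \<in> Q \<Longrightarrow> dist x y + dist z w \<le> dist x' y' + dist z' w'"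
    by (cases v) fastforce
  then show thesis using that Q_iff by metis
qed

lemma planar_hulls_meet_imp_close:
  fixes A C :: "(real^2) set"
  assumes "compact A" "compact C" and meet: "convex hull A \<inter> convex hull C \<noteq> {}"
    and p: "\<And>s. s \<in> convex hull A \<Longrightarrow> \<exists>a\<in>A. dist a s \<le> p"
    and q: "\<And>s. s \<in> convex hull C \<Longrightarrow> \<exists>c\<in>C. dist c s \<le> q"
  shows "\<exists>a\<in>A. \<exists>c\<in>C. (dist a c)\<^sup>2 \<le> p\<^sup>2 + q\<^sup>2"
proof -
  \<comment> \<open>A point of \<open>A\<close> in the hull of \<open>C\<close> is within
    \<open>q\<close> of \<open>C\<close>, so the second square alone suffices.\<close>
  have left: ?thesis if a: "a \<in> A" "a \<in> convex hull C" for a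
  proof -
    obtain c where "c \<in> C" "dist c a \<le> q" using q a by blast
    then show ?thesis using a power_mono[of "dist a c" q 2]
      by (metis dist_commute zero_le_dist add_increasing zero_le_power2)
  qed
  have right: ?thesis if c: "c \<in> C" "c \<in> convex hull A" for c
  proof -
    obtain a where "a \<in> A" "dist a c \<le> p" using p c by blast
    then show ?thesis using c power_mono[of "dist a c" p 2]
      by (metis zero_le_dist add_increasing2 zero_le_power2)
  qed
  show ?thesis
  proof (cases "A \<inter> convex hull C = {} \<and> C \<inter> convex hull A = {}")
    case False
    then show ?thesis using left right by blast
  next
    case disj: True
    obtain a0 a1 c0 c1 where cross: "a0 \<in> A" "a1 \<in> A" "c0 \<in> C" "c1 \<in> C"
      "closed_segment a0 a1 \<inter> closed_segment c0 c1 \<noteq> {}"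
      using hulls_meet_cases[OF meet] disj by (metis disjoint_iff)
    from exists_shortest_crossing[OF assms(1,2) cross] obtain x y z w where
      xyzw: "x \<in> A" "y \<in> A" "z \<in> C" "w \<in> C" "closed_segment x y \<inter> closed_segment z w \<noteq> {}"
      and min: "\<And>x' y' z' w'. \<lbrakk>x' \<in> A; y' \<in> A; z' \<in> C; w' \<in> C;
        closed_segment x' y' \<inter> closed_segment z' w' \<noteq> {}\<rbrakk>
        \<Longrightarrow> dist x y + dist z w \<le> dist x' y' + dist z' w'" by metis
    \<comment> \<open>With \<open>z\<close> and \<open>w\<close> kept, their distance cancels in
      \<open>min\<close>; the second bound cancels \<open>dist x y\<close> instead.\<close>
    have "dist x y \<le> 2 * p"
      by (rule no_shorter_crossing_imp_short[where A = A and ?c0.0 = z and ?c1.0 = w])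
        (use xyzw disj p min[of _ _ z w] in auto)
    moreover have "dist z w \<le> 2 * q"
      by (rule no_shorter_crossing_imp_short[where A = C and ?c0.0 = x and ?c1.0 = y])
        (use xyzw disj q min[of x y] in \<open>auto simp: Int_commute\<close>)
    ultimately show ?thesis
      using crossing_segments_close_endpoints[OF xyzw(5)] xyzw by blast
  qed
qed

section \<open>Basic properties of the distance from a set to its hull\<close>

lemma hull_dist_eq_infdist:
  assumes "A \<noteq> {}"
  shows "hull_dist A = (SUP x \<in> convex hull A. infdist x A)"
  using assms by (simp add: hull_dist_def infdist_def dist_norm norm_minus_commute)

lemma hull_dist_le:
  assumes "A \<noteq> {}" and close: "\<And>x. x \<in> convex hull A \<Longrightarrow> \<exists>a\<in>A. dist a x \<le> r"
  shows "hull_dist A \<le> r"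
  unfolding hull_dist_eq_infdist[OF assms(1)]
proof (rule cSUP_least)
  fix x assume "x \<in> convex hull A"
  from close[OF this] obtain a where "a \<in> A" "dist x a \<le> r" by (auto simp: dist_commute)
  then show "infdist x A \<le> r" by (rule infdist_le2)
qed (use assms in simp)

text \<open>The hull is compact and \<open>infdist\<close> is continuous, so the values are bounded
  and the real supremum is a genuine upper bound.\<close>

lemma infdist_le_hull_dist:
  assumes "compact A" "A \<noteq> {}" "x \<in> convex hull A"
  shows "infdist x A \<le> hull_dist A"
proof -
  have "compact ((\<lambda>x. infdist x A) ` (convex hull A))"
    using assms by (intro compact_continuous_image compact_convex_hull continuous_intros)
  then show ?thesis unfolding hull_dist_eq_infdist[OF assms(2)]
    using assms by (intro cSUP_upper) (auto intro: bounded_imp_bdd_above compact_imp_bounded)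
qed

lemma hull_dist_attained:
  assumes "compact A" "A \<noteq> {}" "x \<in> convex hull A"
  shows "\<exists>a\<in>A. dist a x \<le> hull_dist A"
proof -
  obtain a where "a \<in> A" "infdist x A = dist x a"
    using infdist_attains_inf[of A x] assms compact_imp_closed by blast
  then show ?thesis using infdist_le_hull_dist[OF assms] by (auto simp: dist_commute)
qed

lemma hull_dist_nonneg:
  assumes "compact A" "A \<noteq> {}"
  shows "0 \<le> hull_dist A"
proof -
  obtain a where "a \<in> A" using assms(2) by blast
  then have "infdist a A \<le> hull_dist A" using assms by (intro infdist_le_hull_dist hull_inc)
  then show ?thesis using infdist_nonneg order_trans by blast
qed

lemma hull_dist_ge:
  assumes "compact A" "A \<noteq> {}" "x \<in> convex hull A" "\<And>a. a \<in> A \<Longrightarrow> r \<le> dist a x"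
  shows "r \<le> hull_dist A"
  using hull_dist_attained[OF assms(1-3)] assms(4) by fastforce

section \<open>The upper bound for Minkowski sums\<close>

lemma compact_set_plus:
  fixes A B :: "'a::real_normed_vector set"
  assumes "compact A" "compact B"
  shows "compact (A + B)"
proof -
  have "A + B = {x + y | x y. x \<in> A \<and> y \<in> B}" by (auto simp: set_plus_def)
  then show ?thesis using compact_sums[OF assms] by simp
qed

lemma hull_dist_plus_le:
  fixes A B :: "(real^2) set"
  assumes "compact A" "compact B"
  shows "(hull_dist (A + B))\<^sup>2 \<le> (hull_dist A)\<^sup>2 + (hull_dist B)\<^sup>2"
proof (cases "A = {} \<or> B = {}")
  case True
  \<comment> \<open>The sum is empty and hence equals a summand, so the unspecified value of
    \<open>hull_dist {}\<close> does no harm.\<close>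
  then have "A + B = A \<or> A + B = B" by (auto simp: set_plus_def)
  then show ?thesis by auto
next
  case False
  then have ne: "A \<noteq> {}" "B \<noteq> {}" "A + B \<noteq> {}" by (auto simp: set_plus_def)
  let ?r = "sqrt ((hull_dist A)\<^sup>2 + (hull_dist B)\<^sup>2)"
  have "\<exists>y\<in>A + B. dist y x \<le> ?r" if x: "x \<in> convex hull (A + B)" for x
  proof -
    obtain a b where ab: "x = a + b" "a \<in> convex hull A" "b \<in> convex hull B"
      using x unfolding convex_hull_set_plus by (auto simp: set_plus_def)
    \<comment> \<open>Reflection of \<open>B\<close>: since \<open>a = x - b\<close>, the hulls of
      \<open>A\<close> and \<open>?C\<close> meet in \<open>a\<close>, and a distance from
      \<open>A\<close> to \<open>?C\<close> is one from \<open>A + B\<close> to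
      \<open>x\<close>.\<close>
    let ?C = "(\<lambda>y. x - y) ` B"
    have hull_C: "convex hull ?C = (\<lambda>y. x - y) ` (convex hull B)"
      using convex_hull_affinity[of x "-1" B] by simp
    have "\<exists>a\<in>A. \<exists>c\<in>?C. (dist a c)\<^sup>2 \<le> (hull_dist A)\<^sup>2 + (hull_dist B)\<^sup>2"
    proof (rule planar_hulls_meet_imp_close)
      show "compact ?C"
        using assms by (intro compact_continuous_image continuous_intros)
      have "a \<in> convex hull ?C" unfolding hull_C using ab by force
      then show "convex hull A \<inter> convex hull ?C \<noteq> {}" using ab by blast
      show "\<exists>c\<in>?C. dist c s \<le> hull_dist B" if s: "s \<in> convex hull ?C" for s
      proof -
        obtain y where y: "y \<in> convex hull B" "s = x - y" using s hull_C by auto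
        then obtain b' where "b' \<in> B" "dist b' y \<le> hull_dist B"
          using hull_dist_attained assms ne by blast
        then show ?thesis using y by (force simp: dist_norm norm_minus_commute)
      qed
    qed (use assms ne hull_dist_attained in auto)
    then obtain a' b' where *: "a' \<in> A" "b' \<in> B"
      "(dist a' (x - b'))\<^sup>2 \<le> (hull_dist A)\<^sup>2 + (hull_dist B)\<^sup>2" by auto
    have "dist (a' + b') x = dist a' (x - b')" by (simp add: dist_norm algebra_simps)
    then have "dist (a' + b') x \<le> ?r" using * real_le_rsqrt by simp
    then show ?thesis using * by (auto intro: set_plus_intro)
  qed
  then have "hull_dist (A + B) \<le> ?r" by (rule hull_dist_le[OF ne(3)])
  moreover have "0 \<le> hull_dist (A + B)"
    using hull_dist_nonneg ne assms compact_set_plus by blast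
  ultimately show ?thesis using power_mono[of _ ?r 2] by fastforce
qed

section \<open>Sharpness\<close>

lemma zero_in_hull_symmetric_pair: "0 \<in> convex hull {- v, v :: 'a::real_vector}"
  using midpoint_in_closed_segment[of "- v" v] by (simp add: midpoint_def segment_convex_hull)

lemma hull_dist_symmetric_pair: "hull_dist {- v, v} = norm v"
proof (rule antisym)
  show "hull_dist {- v, v} \<le> norm v"
  proof (rule hull_dist_le)
    fix x assume "x \<in> convex hull {- v, v}"
    then obtain t where t: "0 \<le> t" "t \<le> 1" "x = (1 - t) *\<^sub>R (- v) + t *\<^sub>R v"
      by (auto simp: segment_convex_hull[symmetric] closed_segment_def)
    have "- v - x = (- 2 * t) *\<^sub>R v" "v - x = (2 * (1 - t)) *\<^sub>R v"
      unfolding t(3) by (simp_all add: algebra_simps flip: scaleR_2)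
    then have "dist (- v) x = 2 * t * norm v" "dist v x = 2 * (1 - t) * norm v"
      using t by (simp_all add: dist_norm)
    \<comment> \<open>The two coefficients add up to 2, so one of them is at most 1.\<close>
    moreover have "2 * t \<le> 1 \<or> 2 * (1 - t) \<le> 1" using linear[of t "1 / 2"] by auto
    ultimately show "\<exists>a\<in>{- v, v}. dist a x \<le> norm v"
      using mult_right_mono[of _ 1 "norm v"] by fastforce
  qed simp
  show "norm v \<le> hull_dist {- v, v}"
    using zero_in_hull_symmetric_pair by (intro hull_dist_ge[of _ 0]) auto
qed

text \<open>The sumset consists of the vertices of a possibly degenerate rectangle centred at 0. By
  Pythagoras all of them have the same distance from the centre, which lies in the hull.\<close>

lemma hull_dist_plus_orthogonal_pairs:
  fixes v w :: "real^2"
  assumes "v \<bullet> w = 0"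
  shows "(hull_dist ({- v, v} + {- w, w}))\<^sup>2 = (norm v)\<^sup>2 + (norm w)\<^sup>2"
proof (rule antisym)
  show "(hull_dist ({- v, v} + {- w, w}))\<^sup>2 \<le> (norm v)\<^sup>2 + (norm w)\<^sup>2"
    using hull_dist_plus_le[of "{- v, v}" "{- w, w}"] by (simp add: hull_dist_symmetric_pair)
  have "sqrt ((norm v)\<^sup>2 + (norm w)\<^sup>2) \<le> hull_dist ({- v, v} + {- w, w})"
  proof (rule hull_dist_ge[of _ 0])
    show "compact ({- v, v} + {- w, w})" by (intro compact_set_plus) auto
    show "{- v, v} + {- w, w} \<noteq> {}" by (auto simp: set_plus_def)
    show "0 \<in> convex hull ({- v, v} + {- w, w})" unfolding convex_hull_set_plus
      using set_plus_intro[OF zero_in_hull_symmetric_pair zero_in_hull_symmetric_pair] by simp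
    fix a assume "a \<in> {- v, v} + {- w, w}"
    then have "(norm a)\<^sup>2 = (norm v)\<^sup>2 + (norm w)\<^sup>2"
      using assms by (auto simp: set_plus_def power2_norm_eq_inner inner_simps inner_commute)
    then show "sqrt ((norm v)\<^sup>2 + (norm w)\<^sup>2) \<le> dist a 0"
      by (metis dist_0_norm dist_commute norm_ge_zero order_refl real_sqrt_unique)
  qed
  then show "(norm v)\<^sup>2 + (norm w)\<^sup>2 \<le> (hull_dist ({- v, v} + {- w, w}))\<^sup>2"
    using sqrt_le_D by blast
qed

theorem theorem1p4:
  shows "(\<forall>A B :: (real^2) set. compact A \<and> compact B \<longrightarrow>
            (hull_dist (A + B))\<^sup>2 \<le> (hull_dist A)\<^sup>2 + (hull_dist B)\<^sup>2)
       \<and> (\<forall>dA dB :: real. 0 \<le> dA \<and> 0 \<le> dB \<longrightarrow>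
            (\<exists>A B :: (real^2) set. compact A \<and> A \<noteq> {} \<and> compact B \<and> B \<noteq> {} \<and>
               hull_dist A = dA \<and> hull_dist B = dB \<and>
               (hull_dist (A + B))\<^sup>2 = dA\<^sup>2 + dB\<^sup>2))"
proof (intro conjI allI impI)
  fix A B :: "(real^2) set"
  assume "compact A \<and> compact B"
  then show "(hull_dist (A + B))\<^sup>2 \<le> (hull_dist A)\<^sup>2 + (hull_dist B)\<^sup>2"
    by (simp add: hull_dist_plus_le)
next
  fix dA dB :: real
  assume d: "0 \<le> dA \<and> 0 \<le> dB"
  \<comment> \<open>Orthogonal axis vectors of the prescribed lengths; a length 0 turns the pair
    into the singleton of 0.\<close>
  define v w :: "real^2" where "v = axis 1 dA" and "w = axis 2 dB"
  have "v \<bullet> w = 0" "norm v = dA" "norm w = dB"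
    using d by (simp_all add: v_def w_def norm_eq_sqrt_inner inner_axis_axis)
  then show "\<exists>A B :: (real^2) set. compact A \<and> A \<noteq> {} \<and> compact B \<and> B \<noteq> {} \<and>
      hull_dist A = dA \<and> hull_dist B = dB \<and> (hull_dist (A + B))\<^sup>2 = dA\<^sup>2 + dB\<^sup>2"
    using hull_dist_plus_orthogonal_pairs[of v w]
    by (intro exI[of _ "{- v, v}"] exI[of _ "{- w, w}"]) (simp add: hull_dist_symmetric_pair)
qed

end
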